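(* Let $g\ge 2$ and $N$ be integers with $2g\le N-2$. Let $$\Delta+1=\frac{1}{2g+1}\binom{2g+1}{g+1}=\frac{(2g)!}{(g+1)!\,g!}$$ (so $\Delta+1$ is the $g$-th Catalan number), and let $$M_{N-2}=\sum_{\substack{2g\le n\le N-2\\ 2\mid n}}\frac{1}{n+1}\binom{n+1}{\frac n2+1}\binom{n/2}{g}.$$ Then there exists a dominating set $\mathcal D$ of the graph $\mathcal G_{N-2,g}$ of at most $$M_{N-2}\left(1-\frac{\Delta}{(\Delta+1)^{1+\frac1\Delta}}\right)$$ vertices.
   Context: Let $\mathcal S=\{(x,y): x,y\in\mathbb Z,\ x\ge 1,\ y\ge 0\}$. A walk of length $n$ in $\mathcal S$ starting from $(1,0)$ is a sequence of points $S_0=(1,0),S_1,\dots,S_n$ of $\mathcal S$ such that each difference $S_{i}-S_{i-1}$ is one of $(1,0)$ (right step), $(-1,0)$ (left step), $(-1,1)$ (up-and-left step). The graph $\mathcal G_{N-2,g}$ is the simple graph whose vertices are the walks in $\mathcal S$ of length at most $N-2$ starting from $(1,0)$ and finishing at the final point $(1,g)$; two distinct walks $w_1,w_2$ are joined by an edge exactly when they intersect each other in (i.e. both visit) a common point $(C,G)\in\mathcal S$ with $1\le G\le g-1$. A dominating set of a graph is a subset $\mathcal D$ of its vertices such that every vertex is in $\mathcal D$ or has a neighbor in $\mathcal D$. *)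

theory Defs
  imports Complex_Main "HOL-Library.Product_Plus"
begin

definition region :: "(int \<times> int) set" where
  "region = {(x, y). x \<ge> 1 \<and> y \<ge> 0}"

definition steps :: "(int \<times> int) set" where
  "steps = {(1, 0), (- 1, 0), (- 1, 1)}"

(* A walk of length n is the list of its n + 1 points S_0, ..., S_n. *)
definition is_walk :: "nat \<Rightarrow> (int \<times> int) list \<Rightarrow> bool" where
  "is_walk n w \<longleftrightarrow>
     length w = n + 1 \<and> w ! 0 = (1, 0) \<and> set w \<subseteq> region \<and>
     (\<forall>i\<in>{1..n}. w ! i - w ! (i - 1) \<in> steps)"

(* A simple graph is given by its vertex set and its set of edges {u, v} with u \<noteq> v. *)
type_synonym 'a sgraph = "'a set \<times> 'a set set"

definition walk_vertices :: "nat \<Rightarrow> nat \<Rightarrow> (int \<times> int) list set" where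
  "walk_vertices L g = {w. \<exists>n\<le>L. is_walk n w \<and> w ! n = (1, int g)}"

definition meet_inside :: "nat \<Rightarrow> (int \<times> int) list \<Rightarrow> (int \<times> int) list \<Rightarrow> bool" where
  "meet_inside g v w \<longleftrightarrow>
     (\<exists>C G. (C, G) \<in> region \<and> 1 \<le> G \<and> G \<le> int g - 1 \<and> (C, G) \<in> set v \<and> (C, G) \<in> set w)"

definition walk_graph :: "nat \<Rightarrow> nat \<Rightarrow> (int \<times> int) list sgraph" where
  "walk_graph L g =
     (walk_vertices L g,
      {{v, w} | v w. v \<in> walk_vertices L g \<and> w \<in> walk_vertices L g \<and> v \<noteq> w \<and> meet_inside g v w})"

definition dominating_set :: "'a sgraph \<Rightarrow> 'a set \<Rightarrow> bool" where
  "dominating_set H D \<longleftrightarrow>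
     D \<subseteq> fst H \<and> (\<forall>v\<in>fst H. v \<in> D \<or> (\<exists>u\<in>D. {u, v} \<in> snd H))"

definition Delta :: "nat \<Rightarrow> real" where
  "Delta g = 1 / real (2 * g + 1) * real ((2 * g + 1) choose (g + 1)) - 1"

definition M :: "nat \<Rightarrow> nat \<Rightarrow> real" where
  "M L g = (\<Sum>n | 2 * g \<le> n \<and> n \<le> L \<and> 2 dvd n.
     1 / real (n + 1) * real ((n + 1) choose (n div 2 + 1)) * real ((n div 2) choose g))"

lemma Delta_plus_one: "Delta g + 1 = fact (2 * g) / (fact (g + 1) * fact g)"
proof -
  have "real ((2 * g + 1) choose (g + 1)) = fact (2 * g + 1) / (fact (g + 1) * fact g)"
    using binomial_fact[of "g + 1" "2 * g + 1", where 'a = real] by simp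
  also have "fact (2 * g + 1) = real (2 * g + 1) * fact (2 * g)"
    by simp
  finally have b: "real ((2 * g + 1) choose (g + 1)) =
      real (2 * g + 1) * fact (2 * g) / (fact (g + 1) * fact g)" .
  show ?thesis
    unfolding Delta_def b by (simp del: fact_Suc)
qed

end

theory Submission
  imports Defs
begin

text \<open>
  The statement combines a general domination bound with two counting facts about walks.

  \<^item> If every closed neighbourhood of a finite graph has at least \<open>d + 1\<close> vertices, choose each
    vertex with probability \<open>p\<close> and add the vertices whose closed neighbourhood was missed. The
    expected size of the resulting dominating set is at most \<open>card V * (p + (1 - p) ^ (d + 1))\<close>, and
    \<open>1 - p = (d + 1) powr (- 1 / d)\<close> gives the factor of the theorem
    (\<open>dominating_set_of_min_degree\<close>). Here the expectation is replaced by a vertex-by-vertex choice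
    (\<open>sparse_almost_transversal\<close>).

  \<^item> A walk made of \<open>a\<close> right steps and \<open>b\<close> steps to the left is a ballot path in its first
    coordinate, with an arbitrary marking of the steps to the left that also go up. Hence, for
    given \<open>a\<close> and \<open>b\<close>, the number of walks that end in height \<open>k\<close> is \<open>ballot a b * (b choose k)\<close> (\<open>card_walks_to\<close>). Walks
    that return to the first column have \<open>a = b\<close>, so that the ballot number is a Catalan number,
    and therefore \<open>M\<close> is exactly the number of vertices, while \<open>Delta + 1\<close> is exactly the number
    of walks of the minimal length \<open>2 * g\<close>.

  \<^item> Every walk \<open>w\<close> of the graph leaves height \<open>g - 1\<close> through some point \<open>(k + 2, g - 1)\<close>, and every
    walk of length \<open>2 * g\<close> leaves it through \<open>(2, g - 1)\<close>. Putting \<open>k\<close> right steps before a walk of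
    length \<open>2 * g\<close> and \<open>k\<close> left steps after it produces a walk through \<open>(k + 2, g - 1)\<close> which is no
    longer than \<open>w\<close>. So at least \<open>Delta + 1\<close> vertices, including \<open>w\<close>, contain that point
    (\<open>card_closed_neighbours_walk_graph\<close>).
\<close>

section \<open>Dominating sets in graphs of given minimum degree\<close>

text \<open>
  The right-hand side is the expected value of the left-hand side when every element of \<open>U\<close> is
  put into \<open>T\<close> independently with probability \<open>p\<close>. Deciding about the elements one at a time, one
  of the two decisions does not increase the conditional expectation.
\<close>

lemma sparse_almost_transversal:
  fixes p :: real and A :: "'i \<Rightarrow> 'a set"
  assumes "finite U" "finite I" "0 \<le> p" "p \<le> 1"
  shows "\<exists>T\<subseteq>U. real (card T) + real (card {i \<in> I. A i \<inter> T = {}})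
           \<le> p * real (card U) + (\<Sum>i\<in>I. (1 - p) ^ card (A i \<inter> U))"
  using assms(1,2)
proof (induction U arbitrary: I rule: finite_induct)
  case empty
  then show ?case by simp
next
  case (insert x U)
  define f where "f i = (1 - p) ^ card (A i \<inter> U)" for i
  define J where "J = {i \<in> I. x \<in> A i}"
  define K where "K = {i \<in> I. x \<notin> A i}"
  have fin: "finite J" "finite K" and un: "I = J \<union> K" "J \<inter> K = {}"
    using insert.prems by (auto simp: J_def K_def)
  have fJ: "(1 - p) ^ card (A i \<inter> insert x U) = (1 - p) * f i" if "i \<in> J" for i
    using that insert.hyps by (simp add: J_def f_def Int_insert_right)
  have fK: "(1 - p) ^ card (A i \<inter> insert x U) = f i" if "i \<in> K" for i
    using that by (simp add: K_def f_def Int_insert_right)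
  have split: "(\<Sum>i\<in>I. h i) = (\<Sum>i\<in>J. h i) + (\<Sum>i\<in>K. h i)" for h :: "'i \<Rightarrow> real"
    unfolding un(1) using fin un(2) by (rule sum.union_disjoint)
  have goal: "p * real (card (insert x U)) + (\<Sum>i\<in>I. (1 - p) ^ card (A i \<inter> insert x U))
      = p + p * real (card U) + (1 - p) * sum f J + sum f K"
    using insert.hyps by (simp add: split fJ fK sum_distrib_left distrib_left)
  \<comment> \<open>Putting \<open>x\<close> into \<open>T\<close> costs one element and saves the sets in \<open>J\<close>, of which otherwise
    \<open>sum f J\<close> are expected to be missed.\<close>
  show ?case
  proof (cases "1 \<le> sum f J")
    case True
    from insert.IH[OF fin(2)] obtain T where T: "T \<subseteq> U"
      "real (card T) + real (card {i \<in> K. A i \<inter> T = {}}) \<le> p * real (card U) + sum f K"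
      by (auto simp: f_def)
    have "{i \<in> I. A i \<inter> insert x T = {}} = {i \<in> K. A i \<inter> T = {}}"
      by (auto simp: K_def)
    moreover have "card (insert x T) = Suc (card T)"
      using T(1) insert.hyps by (meson card_insert_disjoint finite_subset subsetD)
    moreover have "(1 - p) * 1 \<le> (1 - p) * sum f J"
      using True \<open>p \<le> 1\<close> by (intro mult_left_mono) auto
    ultimately show ?thesis
      using T by (intro exI[of _ "insert x T"]) (auto simp: goal)
  next
    case False
    from insert.IH[OF insert.prems] obtain T where T: "T \<subseteq> U"
      "real (card T) + real (card {i \<in> I. A i \<inter> T = {}}) \<le> p * real (card U) + sum f I"
      by (auto simp: f_def)
    have "p * sum f J \<le> p * 1"
      using False \<open>0 \<le> p\<close> by (intro mult_left_mono) auto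
    then show ?thesis
      using T by (intro exI[of _ T]) (auto simp: goal split[of f] left_diff_distrib)
  qed
qed

definition closed_neighbours :: "'a sgraph \<Rightarrow> 'a \<Rightarrow> 'a set" where
  "closed_neighbours H v = {u \<in> fst H. u = v \<or> {u, v} \<in> snd H}"

text \<open>
  An almost transversal of the closed neighbourhoods becomes a dominating set once the vertices
  with a missed closed neighbourhood are added to it.
\<close>

lemma dominating_set_of_probability:
  fixes H :: "'a sgraph" and p :: real
  assumes "finite (fst H)" "0 \<le> p" "p \<le> 1"
    and deg: "\<And>v. v \<in> fst H \<Longrightarrow> k \<le> card (closed_neighbours H v)"
  shows "\<exists>D. dominating_set H D \<and> finite D \<and>
    real (card D) \<le> real (card (fst H)) * (p + (1 - p) ^ k)"
proof -
  let ?V = "fst H"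
  let ?A = "closed_neighbours H"
  have sub: "?A v \<inter> ?V = ?A v" for v
    by (auto simp: closed_neighbours_def)
  obtain T where T: "T \<subseteq> ?V" "real (card T) + real (card {v \<in> ?V. ?A v \<inter> T = {}})
      \<le> p * real (card ?V) + (\<Sum>v\<in>?V. (1 - p) ^ card (?A v))"
    using sparse_almost_transversal[OF assms(1,1,2,3), of ?A] by (auto simp: sub)
  define D where "D = T \<union> {v \<in> ?V. ?A v \<inter> T = {}}"
  have "D \<subseteq> ?V" using T(1) by (auto simp: D_def)
  have "dominating_set H D"
    unfolding dominating_set_def
  proof (intro conjI ballI)
    fix v assume "v \<in> ?V"
    show "v \<in> D \<or> (\<exists>u\<in>D. {u, v} \<in> snd H)"
    proof (cases "?A v \<inter> T = {}")
      case True
      then show ?thesis using \<open>v \<in> ?V\<close> by (simp add: D_def)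
    next
      case False
      then show ?thesis by (auto simp: D_def closed_neighbours_def)
    qed
  qed fact
  moreover have "finite D"
    using \<open>D \<subseteq> ?V\<close> assms(1) finite_subset by blast
  moreover have "real (card D) \<le> real (card ?V) * (p + (1 - p) ^ k)"
  proof -
    have "card D \<le> card T + card {v \<in> ?V. ?A v \<inter> T = {}}"
      unfolding D_def by (rule card_Un_le)
    then have "real (card D) \<le> real (card T) + real (card {v \<in> ?V. ?A v \<inter> T = {}})"
      by linarith
    also have "\<dots> \<le> p * real (card ?V) + (\<Sum>v\<in>?V. (1 - p) ^ card (?A v))"
      by (rule T(2))
    also have "\<dots> \<le> p * real (card ?V) + (\<Sum>v\<in>?V. (1 - p) ^ k)"
      using deg assms(2,3) by (intro add_left_mono sum_mono power_decreasing) auto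
    finally show ?thesis by (simp add: algebra_simps)
  qed
  ultimately show ?thesis by blast
qed

text \<open>
  The choice of \<open>p\<close> minimises \<open>p + (1 - p) ^ k\<close>: its derivative vanishes where
  \<open>k * (1 - p) ^ (k - 1) = 1\<close>, that is, \<open>(1 - p) powr d = 1 / (d + 1)\<close>.
\<close>

lemma dominating_set_of_min_degree:
  fixes H :: "'a sgraph" and d :: real
  assumes "finite (fst H)" "0 < d" "d + 1 = real k"
    and "\<And>v. v \<in> fst H \<Longrightarrow> k \<le> card (closed_neighbours H v)"
  shows "\<exists>D. dominating_set H D \<and> finite D \<and>
    real (card D) \<le> real (card (fst H)) * (1 - d / (d + 1) powr (1 + 1 / d))"
proof -
  define q where "q = (d + 1) powr (- 1 / d)"
  have q: "0 < q" "q \<le> 1"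
    using powr_mono[of "- 1 / d" 0 "d + 1"] assms(2) by (auto simp: q_def)
  define X where "X = (d + 1) powr (- (1 + 1 / d))"
  have "q ^ k = q powr (d + 1)"
    using q by (simp add: powr_realpow assms(3))
  also have "\<dots> = (d + 1) powr (- 1 / d * (d + 1))"
    unfolding q_def by (rule powr_powr)
  also have "- 1 / d * (d + 1) = - (1 + 1 / d)"
    using assms(2) by (simp add: field_simps)
  finally have qk: "q ^ k = X" by (simp only: X_def)
  have "q = (d + 1) powr (1 + - (1 + 1 / d))"
    by (simp add: q_def)
  also have "\<dots> = (d + 1) * X"
    unfolding powr_add X_def using assms(2) by simp
  finally have qX: "q = (d + 1) * X" .
  have "(1 - q) + (1 - (1 - q)) ^ k = 1 - d * X"
    using qk qX by (simp add: algebra_simps)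
  also have "d * X = d / (d + 1) powr (1 + 1 / d)"
    unfolding X_def powr_minus by (simp add: divide_inverse)
  finally have eq: "(1 - q) + (1 - (1 - q)) ^ k = 1 - d / (d + 1) powr (1 + 1 / d)" .
  have "0 \<le> 1 - q" "1 - q \<le> 1" using q by auto
  from dominating_set_of_probability[OF assms(1) this assms(4)] show ?thesis
    unfolding eq .
qed

section \<open>Walks and ballot numbers\<close>

definition walks_to :: "nat \<Rightarrow> int \<times> int \<Rightarrow> (int \<times> int) list set" where
  "walks_to n p = {w. is_walk n w \<and> w ! n = p}"

lemma is_walk_nth_region: "is_walk n w \<Longrightarrow> i \<le> n \<Longrightarrow> w ! i \<in> region"
  unfolding is_walk_def by (metis Suc_eq_plus1 le_imp_less_Suc nth_mem subsetD)

lemma is_walk_step: "is_walk n w \<Longrightarrow> i < n \<Longrightarrow> w ! Suc i - w ! i \<in> steps"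
  unfolding is_walk_def by (auto dest!: bspec[of _ _ "Suc i"])

lemma is_walk_stepE:
  assumes "is_walk n w" "i < n"
  obtains "fst (w ! Suc i) = fst (w ! i) + 1" "snd (w ! Suc i) = snd (w ! i)"
    | "fst (w ! Suc i) = fst (w ! i) - 1" "snd (w ! Suc i) = snd (w ! i)"
    | "fst (w ! Suc i) = fst (w ! i) - 1" "snd (w ! Suc i) = snd (w ! i) + 1"
  using is_walk_step[OF assms] by (cases "w ! i"; cases "w ! Suc i") (auto simp: steps_def)

lemma is_walk_snoc:
  assumes "length v = n + 1"
  shows "is_walk (Suc n) (v @ [p]) \<longleftrightarrow> is_walk n v \<and> p \<in> region \<and> p - v ! n \<in> steps"
proof -
  have "{1..Suc n} = insert (Suc n) {1..n}" by auto
  then show ?thesis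
    using assms by (auto simp: is_walk_def nth_append)
qed

lemma walks_to_0: "walks_to 0 p = (if p = (1, 0) then {[(1, 0)]} else {})"
  by (auto simp: walks_to_def is_walk_def length_Suc_conv region_def)

lemma walks_to_outside: "p \<notin> region \<Longrightarrow> walks_to n p = {}"
  using is_walk_nth_region by (auto simp: walks_to_def)

lemma walks_to_Suc:
  assumes "p \<in> region"
  shows "walks_to (Suc n) p = (\<Union>s\<in>steps. (\<lambda>v. v @ [p]) ` walks_to n (p - s))"
proof (intro equalityI subsetI)
  fix w assume w: "w \<in> walks_to (Suc n) p"
  then have len: "length w = Suc (Suc n)" and wn: "w ! Suc n = p"
    by (auto simp: walks_to_def is_walk_def)
  define v where "v = butlast w"
  have "w \<noteq> []" using len by auto
  then have wv: "w = v @ [p]"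
    using len wn append_butlast_last_id[of w] by (simp add: v_def last_conv_nth)
  have v: "length v = n + 1" using len by (simp add: v_def)
  have "is_walk n v" "p - v ! n \<in> steps"
    using w is_walk_snoc[OF v] by (auto simp: walks_to_def wv)
  then have "v \<in> walks_to n (p - (p - v ! n))"
    by (simp add: walks_to_def)
  with \<open>p - v ! n \<in> steps\<close> show "w \<in> (\<Union>s\<in>steps. (\<lambda>v. v @ [p]) ` walks_to n (p - s))"
    unfolding wv by blast
next
  fix w assume "w \<in> (\<Union>s\<in>steps. (\<lambda>v. v @ [p]) ` walks_to n (p - s))"
  then obtain s v where s: "s \<in> steps" "v \<in> walks_to n (p - s)" "w = v @ [p]" by blast
  then have v: "length v = n + 1" by (simp add: walks_to_def is_walk_def)
  show "w \<in> walks_to (Suc n) p"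
    using s assms v by (auto simp: walks_to_def is_walk_snoc nth_append)
qed

lemma finite_walks_to [simp]: "finite (walks_to n p)"
proof (induction n arbitrary: p)
  case 0
  then show ?case by (simp add: walks_to_0)
next
  case (Suc n)
  have "finite steps" by (simp add: steps_def)
  with Suc show ?case
    by (cases "p \<in> region") (auto simp: walks_to_Suc walks_to_outside)
qed

lemma card_walks_to_Suc:
  assumes "p \<in> region"
  shows "card (walks_to (Suc n) p) = (\<Sum>s\<in>steps. card (walks_to n (p - s)))"
proof -
  have disj: "(\<lambda>v. v @ [p]) ` walks_to n (p - s) \<inter> (\<lambda>v. v @ [p]) ` walks_to n (p - t) = {}"
    if "s \<noteq> t" for s t
    using that by (auto simp: walks_to_def)
  have "card (walks_to (Suc n) p) = (\<Sum>s\<in>steps. card ((\<lambda>v. v @ [p]) ` walks_to n (p - s)))"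
    unfolding walks_to_Suc[OF assms]
  proof (intro card_UN_disjoint ballI impI)
    show "finite steps" by (simp add: steps_def)
  qed (simp, rule disj)
  also have "\<dots> = (\<Sum>s\<in>steps. card (walks_to n (p - s)))"
    by (intro sum.cong refl card_image inj_onI) auto
  finally show ?thesis .
qed

text \<open>The parameter \<open>b\<close> is the number of the first \<open>i\<close> steps that go to the left.\<close>

lemma is_walk_column:
  assumes "is_walk n w" "i \<le> n"
  shows "\<exists>b\<le>i. fst (w ! i) = 1 + int i - 2 * int b"
  using assms(2)
proof (induction i)
  case 0
  then show ?case using assms(1) by (simp add: is_walk_def)
next
  case (Suc i)
  then obtain b where b: "b \<le> i" "fst (w ! i) = 1 + int i - 2 * int b" by auto
  from assms(1) Suc.prems have "i < n" by simp
  with assms(1) show ?case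
  proof (cases rule: is_walk_stepE)
    case 1
    then show ?thesis using b by (intro exI[of _ b]) auto
  qed (use b in \<open>(intro exI[of _ "Suc b"], auto)+\<close>)
qed

text \<open>
  The number of sequences of \<open>a\<close> up-steps and \<open>b\<close> down-steps that never go below their starting
  height, for \<open>b \<le> Suc a\<close>: by the reflection principle, the sequences that do are counted by the
  second binomial coefficient.
\<close>

definition ballot :: "nat \<Rightarrow> nat \<Rightarrow> int" where
  "ballot a b = int ((a + b) choose b) - int ((a + b) choose (Suc a))"

lemma ballot_0_right [simp]: "ballot a 0 = 1"
  by (simp add: ballot_def binomial_eq_0)

lemma ballot_Suc_Suc: "ballot (Suc a) (Suc b) = ballot a (Suc b) + ballot (Suc a) b"
  by (simp add: ballot_def)

lemma ballot_boundary [simp]: "ballot a (Suc a) = 0"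
  by (simp add: ballot_def)

text \<open>
  With \<open>b\<close> steps to the left in total, any \<open>k\<close> of them may be the ones that go up. The case
  \<open>b = Suc a\<close> concerns the column \<open>0\<close>, just outside the region; including it lets the recursion
  over the last step run without exceptions at the boundary.
\<close>

lemma card_walks_to:
  assumes "b \<le> Suc a"
  shows "int (card (walks_to (a + b) (1 + int a - int b, int k))) = ballot a b * int (b choose k)"
  using assms
proof (induction "a + b" arbitrary: a b k)
  case 0
  then show ?case by (cases k) (simp_all add: walks_to_0)
next
  case (Suc n)
  show ?case
  proof (cases "b = Suc a")
    case True
    then show ?thesis by (simp add: walks_to_outside region_def)
  next
    case False
    with Suc.prems have "b \<le> a" by simp
    with Suc.hyps(2) obtain c where c: "a = Suc c" by (cases a) auto
    have n: "n = c + b" using Suc.hyps(2) c by simp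
    have reg: "(1 + int a - int b, int k) \<in> region"
      using \<open>b \<le> a\<close> by (simp add: region_def)
    let ?W = "\<lambda>x y. int (card (walks_to n (x, y)))"
    have rec: "int (card (walks_to (a + b) (1 + int a - int b, int k)))
        = ?W (1 + int c - int b) (int k) + ?W (2 + int a - int b) (int k)
          + ?W (2 + int a - int b) (int k - 1)"
      unfolding Suc.hyps(2)[symmetric] card_walks_to_Suc[OF reg]
      by (simp add: steps_def c algebra_simps)
    have right: "?W (1 + int c - int b) (int k) = ballot c b * int (b choose k)"
      using Suc.hyps(1)[of c b k] \<open>b \<le> a\<close> n c by simp
    show ?thesis
    proof (cases b)
      case 0
      have "walks_to n (2 + int a - int b, y) = {}" for y
      proof (rule equals0I)
        fix w assume "w \<in> walks_to n (2 + int a - int b, y)"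
        then show False
          using is_walk_column[of n w n] n c 0 by (auto simp: walks_to_def)
      qed
      then show ?thesis
        unfolding rec right using 0 by simp
    next
      case (Suc e)
      have left: "?W (2 + int a - int b) (int j) = ballot a e * int (e choose j)" for j
        using Suc.hyps(1)[of a e j] \<open>b \<le> a\<close> n c Suc by (simp add: algebra_simps)
      have "ballot a b = ballot c b + ballot a e"
        by (simp add: c Suc ballot_Suc_Suc)
      moreover have "?W (2 + int a - int b) (int k - 1) =
          ballot a e * (int (b choose k) - int (e choose k))"
      proof (cases k)
        case 0
        then show ?thesis by (simp add: walks_to_outside region_def)
      next
        case (Suc j)
        then show ?thesis using left[of j] \<open>b = Suc e\<close> by simp
      qed
      ultimately show ?thesis
        unfolding rec right left by (simp add: algebra_simps)
    qed
  qed
qed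

lemma ballot_diagonal:
  "real_of_int (ballot m m) = 1 / real (2 * m + 1) * real ((2 * m + 1) choose (m + 1))"
proof -
  have "Suc m * (2 * m choose Suc m) = m * (2 * m choose m)"
    using binomial_absorb_comp[of "2 * m" m] binomial_absorption[of m "2 * m"] 
      by (simp add: mult_2 times_binomial_minus1_eq)
  then have "real (m + 1) * real (2 * m choose Suc m) = real m * real (2 * m choose m)"
    by (metis Suc_eq_plus1 of_nat_mult)
  then have ballot: "real (m + 1) * real_of_int (ballot m m) = real (2 * m choose m)"
    by (simp add: ballot_def flip: mult_2) (simp add: algebra_simps)
  have "Suc m * (Suc (2 * m) choose Suc m) = Suc (2 * m) * (2 * m choose m)"
    by (rule Suc_times_binomial)
  then have "real (m + 1) * real ((2 * m + 1) choose (m + 1)) =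
      real (2 * m + 1) * real (2 * m choose m)"
    by (metis Suc_eq_plus1 of_nat_mult)
  also have "\<dots> = real (m + 1) * (real (2 * m + 1) * real_of_int (ballot m m))"
    unfolding ballot[symmetric] by (rule mult.left_commute)
  finally have "real ((2 * m + 1) choose (m + 1)) = real (2 * m + 1) * real_of_int (ballot m m)"
    unfolding mult_cancel_left by simp
  then show ?thesis by simp
qed

lemma card_walks_to_first_column:
  "real (card (walks_to (2 * m) (1, int g))) =
     1 / real (2 * m + 1) * real ((2 * m + 1) choose (m + 1)) * real (m choose g)"
proof -
  have "int (card (walks_to (2 * m) (1, int g))) = ballot m m * int (m choose g)"
    using card_walks_to[of m m g] by (simp add: mult_2)
  then have "real (card (walks_to (2 * m) (1, int g))) =
      real_of_int (ballot m m) * real (m choose g)"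
    by (metis of_int_mult of_int_of_nat_eq)
  then show ?thesis by (simp only: ballot_diagonal)
qed

section \<open>The order of the graph\<close>

lemma walk_vertices_eq: "walk_vertices L g = (\<Union>n\<le>L. walks_to n (1, int g))"
  by (auto simp: walk_vertices_def walks_to_def)

lemma finite_walk_vertices: "finite (walk_vertices L g)"
  by (simp add: walk_vertices_eq)

lemma card_walk_vertices: "real (card (walk_vertices L g)) = M L g"
proof -
  let ?S = "{n. 2 * g \<le> n \<and> n \<le> L \<and> 2 dvd n}"
  have "walks_to m p \<inter> walks_to n p = {}" if "m \<noteq> n" for m n p
    using that by (auto simp: walks_to_def is_walk_def)
  then have "card (walk_vertices L g) = (\<Sum>n\<le>L. card (walks_to n (1, int g)))"
    unfolding walk_vertices_eq by (intro card_UN_disjoint) auto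
  also have "\<dots> = (\<Sum>n\<in>?S. card (walks_to n (1, int g)))"
  proof (intro sum.mono_neutral_right ballI)
    fix n assume n: "n \<in> {..L} - ?S"
    show "card (walks_to n (1, int g)) = 0"
    proof (cases "2 dvd n")
      case True
      then obtain m where "n = 2 * m" by blast
      with n have "m < g" by auto
      then have "real (card (walks_to n (1, int g))) = 0"
        unfolding \<open>n = 2 * m\<close> card_walks_to_first_column by simp
      then show ?thesis by simp
    next
      case False
      have "w \<notin> walks_to n (1, int g)" for w
      proof
        assume "w \<in> walks_to n (1, int g)"
        then obtain b where "1 = 1 + int n - 2 * int b"
          using is_walk_column[of n w n] by (auto simp: walks_to_def)
        then have "n = 2 * b" by simp
        with False show False by simp
      qed
      then have "walks_to n (1, int g) = {}" by blast
      then show ?thesis by simp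
    qed
  qed auto
  also have "real \<dots> = M L g"
    unfolding M_def of_nat_sum
  proof (intro sum.cong refl)
    fix n assume "n \<in> ?S"
    then obtain m where "n = 2 * m" by blast
    then show "real (card (walks_to n (1, int g))) =
        1 / real (n + 1) * real ((n + 1) choose (n div 2 + 1)) * real ((n div 2) choose g)"
      using card_walks_to_first_column[of m g] by simp
  qed
  finally show ?thesis .
qed

lemma card_shortest_walks: "real (card (walks_to (2 * g) (1, int g))) = Delta g + 1"
  by (simp add: card_walks_to_first_column Delta_def)

section \<open>Closed neighbourhoods in the graph\<close>

text \<open>
  A point \<open>(x, y)\<close> cannot be reached in fewer than \<open>x - 1 + 2 * y\<close> steps, because each of the three
  kinds of steps raises \<open>x + 2 * y\<close> by at most one.
\<close>

lemma is_walk_early: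
  assumes "is_walk n w" "i \<le> n"
  shows "fst (w ! i) - 1 + 2 * snd (w ! i) \<le> int i"
  using assms(2)
proof (induction i)
  case 0
  then show ?case using assms(1) by (simp add: is_walk_def)
next
  case (Suc i)
  from assms(1) Suc.prems have "i < n" by simp
  with assms(1) show ?case
    by (cases rule: is_walk_stepE) (use Suc in auto)
qed

lemma is_walk_late:
  assumes "is_walk n w" "i \<le> n"
  shows "fst (w ! i) - fst (w ! n) \<le> int n - int i"
  using assms(2)
proof (induction rule: inc_induct)
  case (step i)
  from assms(1) step.hyps(2) show ?case
    by (cases rule: is_walk_stepE) (use step in auto)
qed simp

text \<open>
  The step that first attains height \<open>h + 1\<close> goes up and to the left, so it cannot start in the
  first column.
\<close>

lemma is_walk_leaves_height:
  assumes w: "is_walk n w" and h: "0 \<le> h" "h < snd (w ! n)"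
  shows "\<exists>i C. i < n \<and> 2 \<le> C \<and> w ! i = (C, h)"
proof -
  define P where "P j \<longleftrightarrow> h < snd (w ! j)" for j
  define j where "j = (LEAST j. P j)"
  have "P n" using h by (simp add: P_def)
  then have "P j" "j \<le> n"
    unfolding j_def by (rule LeastI, rule Least_le)
  have "\<not> P 0"
    using w h by (simp add: P_def is_walk_def)
  with \<open>P j\<close> obtain i where i: "j = Suc i" by (cases j) auto
  have "\<not> P i"
    using not_less_Least[of i P] i by (simp add: j_def)
  have "i < n" using i \<open>j \<le> n\<close> by simp
  moreover from w \<open>i < n\<close> have "snd (w ! i) = h \<and> fst (w ! Suc i) = fst (w ! i) - 1"
    by (cases rule: is_walk_stepE) (use \<open>P j\<close> \<open>\<not> P i\<close> i in \<open>auto simp: P_def\<close>)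
  moreover have "w ! Suc i \<in> region"
    using is_walk_nth_region[OF w] i \<open>j \<le> n\<close> by simp
  ultimately show ?thesis
    by (intro exI[of _ i] exI[of _ "fst (w ! i)"]) (auto simp: region_def prod_eq_iff)
qed

text \<open>
  A walk that leaves height \<open>g - 1\<close> from column \<open>C\<close> has spent \<open>C + 2 * g - 3\<close> steps before and needs
  \<open>C - 1\<close> more, so a total of \<open>2 * g\<close> steps leaves no choice but \<open>C = 2\<close>.
\<close>

lemma shortest_walk_visits:
  assumes v: "v \<in> walks_to (2 * g) (1, int g)" and "1 \<le> g"
  shows "(2, int g - 1) \<in> set v"
proof -
  have walk: "is_walk (2 * g) v" and last: "v ! (2 * g) = (1, int g)"
    using v by (auto simp: walks_to_def)
  have "0 \<le> int g - 1" "int g - 1 < snd (v ! (2 * g))"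
    using \<open>1 \<le> g\<close> last by auto
  from is_walk_leaves_height[OF walk this]
  obtain i C where i: "i < 2 * g" "2 \<le> C" "v ! i = (C, int g - 1)" by blast
  have "C - 1 + 2 * (int g - 1) \<le> int i" "C - 1 \<le> 2 * int g - int i"
    using is_walk_early[OF walk, of i] is_walk_late[OF walk, of i] i last by auto
  with i(2) have "C = 2" by presburger
  then show ?thesis
    using i walk by (metis Suc_eq_plus1 is_walk_def less_SucI nth_mem)
qed

text \<open>
  Shifting a walk by one column to the right and adding a right step in front of it and a left
  step behind it is injective and preserves the final point.
\<close>

lemma walks_through_shift:
  "card {v \<in> walks_to n (1, y). (C, G) \<in> set v}
     \<le> card {v \<in> walks_to (n + 2) (1, y). (C + 1, G) \<in> set v}"
proof -
  define sh where "sh p = p + (1, 0)" for p :: "int \<times> int"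
  define lift where "lift v = ((1, 0) # map sh v) @ [(1, y)]" for v
  have "lift v \<in> walks_to (n + 2) (1, y)" if v: "v \<in> walks_to n (1, y)" for v
  proof -
    have walk: "is_walk n v" and last: "v ! n = (1, y)"
      and len: "length v = n + 1" and start: "v ! 0 = (1, 0)"
      using v by (auto simp: walks_to_def is_walk_def)
    have "(1, y) \<in> region"
      using is_walk_nth_region[OF walk, of n] last by simp
    have "((1, 0) # map sh v) ! i - ((1, 0) # map sh v) ! (i - 1) \<in> steps"
      if "i \<in> {1..Suc n}" for i
    proof (cases "i = 1")
      case True
      then show ?thesis using len start by (simp add: sh_def steps_def)
    next
      case False
      with that obtain k where k: "i = Suc (Suc k)" "k < n"
        by (cases i rule: nat.exhaust; cases "i - 1") auto
      then show ?thesis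
        using is_walk_step[OF walk, of k] len by (simp add: sh_def)
    qed
    moreover have "set ((1, 0) # map sh v) \<subseteq> region"
      using walk by (auto simp: is_walk_def region_def sh_def)
    ultimately have "is_walk (Suc n) ((1, 0) # map sh v)"
      using len by (simp add: is_walk_def)
    moreover have "(1, y) - ((1, 0) # map sh v) ! Suc n \<in> steps"
      using last len by (simp add: sh_def steps_def)
    ultimately have "is_walk (Suc (Suc n)) (lift v)"
      unfolding lift_def using is_walk_snoc[of "(1, 0) # map sh v" "Suc n"] len
        \<open>(1, y) \<in> region\<close> by simp
    then show ?thesis
      using len by (simp add: walks_to_def lift_def nth_append)
  qed
  moreover have "(C + 1, G) \<in> set (lift v)" if "(C, G) \<in> set v" for v
    using that by (force simp: lift_def sh_def)
  moreover have "inj lift"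
    by (auto simp: lift_def sh_def inj_def inj_map_eq_map)
  ultimately show ?thesis
    by (intro card_inj_on_le[of lift]) (auto intro: inj_on_subset)
qed

lemma shortest_walks_shifted:
  assumes "1 \<le> g"
  shows "card (walks_to (2 * g) (1, int g))
    \<le> card {v \<in> walks_to (2 * g + 2 * k) (1, int g). (int k + 2, int g - 1) \<in> set v}"
proof (induction k)
  case 0
  have "walks_to (2 * g) (1, int g) =
      {v \<in> walks_to (2 * g) (1, int g). (2, int g - 1) \<in> set v}"
    using shortest_walk_visits assms by blast
  then show ?case by simp
next
  case (Suc k)
  then show ?case
    using walks_through_shift[of "2 * g + 2 * k" "int g" "int k + 2" "int g - 1"]
    by (simp add: algebra_simps)
qed

text \<open>
  All walks through the point \<open>(k + 2, g - 1)\<close> of \<open>w\<close> are equal or adjacent to \<open>w\<close>. Reaching this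
  point takes at least \<open>2 * g + k - 1\<close> steps, and returning to the first column at least \<open>k + 1\<close>
  more, so that the walks of length \<open>2 * g + 2 * k\<close> obtained by shifting are vertices too.
\<close>

lemma card_closed_neighbours_walk_graph:
  assumes "2 \<le> g" and w: "w \<in> walk_vertices L g"
  shows "card (walks_to (2 * g) (1, int g)) \<le> card (closed_neighbours (walk_graph L g) w)"
proof -
  obtain n where n: "n \<le> L" and walk: "is_walk n w" and last: "w ! n = (1, int g)"
    using w by (auto simp: walk_vertices_def)
  have "0 \<le> int g - 1" "int g - 1 < snd (w ! n)"
    using assms(1) last by auto
  from is_walk_leaves_height[OF walk this]
  obtain i C where i: "i < n" "2 \<le> C" "w ! i = (C, int g - 1)" by blast
  define k where "k = nat (C - 2)"
  have C: "C = int k + 2" using i(2) by (simp add: k_def)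
  have "2 * g + 2 * k \<le> L"
    using is_walk_early[OF walk, of i] is_walk_late[OF walk, of i] i last n C by simp
  have mem: "(C, int g - 1) \<in> set w"
    using i walk by (metis Suc_eq_plus1 is_walk_def less_SucI nth_mem)
  have "(C, int g - 1) \<in> region" "1 \<le> int g - 1"
    using i(2) assms(1) by (auto simp: region_def)
  then have meet: "meet_inside g v w" if "(C, int g - 1) \<in> set v" for v
    using that mem unfolding meet_inside_def by blast
  have "{v \<in> walks_to (2 * g + 2 * k) (1, int g). (C, int g - 1) \<in> set v}
      \<subseteq> closed_neighbours (walk_graph L g) w"
  proof
    fix v assume v: "v \<in> {v \<in> walks_to (2 * g + 2 * k) (1, int g). (C, int g - 1) \<in> set v}"
    then have "v \<in> walk_vertices L g"
      using \<open>2 * g + 2 * k \<le> L\<close> unfolding walk_vertices_eq by blast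
    moreover have "meet_inside g v w" using v meet by blast
    ultimately show "v \<in> closed_neighbours (walk_graph L g) w"
      using w by (auto simp: closed_neighbours_def walk_graph_def)
  qed
  moreover have "finite (closed_neighbours (walk_graph L g) w)"
    by (rule finite_subset[OF _ finite_walk_vertices[of L g]])
      (auto simp: closed_neighbours_def walk_graph_def)
  ultimately have "card {v \<in> walks_to (2 * g + 2 * k) (1, int g). (C, int g - 1) \<in> set v}
      \<le> card (closed_neighbours (walk_graph L g) w)"
    by (simp add: card_mono)
  with shortest_walks_shifted[of g k] assms(1) show ?thesis
    unfolding C by linarith
qed

lemma Delta_pos:
  assumes "2 \<le> g"
  shows "0 < Delta g"
proof -
  have "(2 * g + 1) choose 1 < (2 * g + 1) choose g"
    using assms by (intro binomial_strict_mono) auto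
  also have "(2 * g + 1) choose g = (2 * g + 1) choose (g + 1)"
    by (subst binomial_symmetric) auto
  finally show ?thesis
    by (simp add: Delta_def field_simps)
qed

theorem theorem3p5:
  fixes g N :: nat
  assumes "2 \<le> g"
    and "2 * g \<le> N - 2"
  shows "\<exists>D. dominating_set (walk_graph (N - 2) g) D \<and> finite D \<and>
    real (card D) \<le> M (N - 2) g * (1 - Delta g / (Delta g + 1) powr (1 + 1 / Delta g))"
proof -
  have V: "fst (walk_graph (N - 2) g) = walk_vertices (N - 2) g"
    by (simp add: walk_graph_def)
  show ?thesis
    using dominating_set_of_min_degree[of "walk_graph (N - 2) g" "Delta g"
        "card (walks_to (2 * g) (1, int g))"]
      card_closed_neighbours_walk_graph[OF assms(1)] card_shortest_walks[of g]
      Delta_pos[OF assms(1)] finite_walk_vertices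
    by (simp add: V card_walk_vertices)
qed

end
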